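(* Let $S=\{x_1,x_2,\ldots,x_n\}$ be a GCD closed set of distinct positive integers, where every element $x_i\in S$ has at most two distinct prime divisors. Then the LCM matrix $[S]$ is invertible.
   Context: A finite set $S=\{x_1,\ldots,x_n\}$ of distinct positive integers is GCD closed if $\gcd(x_i,x_j)\in S$ for all $i,j$. The LCM matrix $[S]$ is the $n\times n$ matrix whose $ij$ entry is $\mathrm{lcm}(x_i,x_j)$. *)

theory Defs
  imports "Jordan_Normal_Form.Matrix" "HOL-Computational_Algebra.Primes"
begin

definition gcd_closed :: "nat set \<Rightarrow> bool" where
  "gcd_closed S \<longleftrightarrow> (\<forall>a\<in>S. \<forall>b\<in>S. gcd a b \<in> S)"

text \<open>
  Rows and columns are indexed from \<open>0\<close>, so \<open>x 0, \<dots>, x (n - 1)\<close> enumerates the set. The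
  entries are taken in the reals because an integer matrix is called invertible when it is
  nonsingular, not when it has an integer inverse.
\<close>
definition lcm_matrix :: "nat \<Rightarrow> (nat \<Rightarrow> nat) \<Rightarrow> real mat" where
  "lcm_matrix n x = mat n n (\<lambda>(i, j). real (lcm (x i) (x j)))"

end

theory Submission
  imports Defs "Jordan_Normal_Form.Determinant"
begin

text \<open>
  Since \<open>lcm a b = a * b / gcd a b\<close>, the matrix is congruent to the one with entries
  \<open>1 / gcd a b\<close>. Let \<open>\<psi>\<close> be the Moebius inverse of \<open>a \<mapsto> 1 / a\<close> on the poset of \<open>S\<close> under
  divisibility. As \<open>S\<close> is gcd closed, \<open>1 / gcd a b\<close> is the sum of \<open>\<psi> s\<close> over the common divisors
  \<open>s \<in> S\<close> of \<open>a\<close> and \<open>b\<close>, so the matrix factors through the (unitriangular) incidence matrix, and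
  it is invertible iff \<open>\<psi>\<close> vanishes nowhere on \<open>S\<close>.

  Now \<open>\<psi> x = 1 / x - h\<close>, where \<open>h\<close> is the sum of \<open>\<psi>\<close> over the proper divisors of \<open>x\<close> in \<open>S\<close>.
  If these are the divisors in \<open>S\<close> of a single \<open>y\<close>, then \<open>h = 1 / y > 1 / x\<close>. Otherwise \<open>h < 0\<close>:
  the exponents of the two primes put the divisors of \<open>x\<close> into a planar grid, where the down-set can
  be built up from a union of two principal down-sets by adding one principal down-set at a time,
  each meeting the previous ones in a principal down-set. The first union contributes
  \<open>1 / y + 1 / t - 1 / gcd y t < 0\<close>, and each later step \<open>1 / t - 1 / gcd t t' < 0\<close>.
\<close>

section \<open>Moebius inversion over divisibility in a set\<close>

function dvd_moebius :: "nat set \<Rightarrow> (nat \<Rightarrow> real) \<Rightarrow> nat \<Rightarrow> real" where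
  "dvd_moebius S f a = f a - (\<Sum>s\<in>{s\<in>S. s dvd a \<and> s < a}. dvd_moebius S f s)"
  by auto
termination by (relation "measure (\<lambda>(S, f, a). a)") auto

declare dvd_moebius.simps [simp del]

lemma sum_dvd_moebius:
  assumes "a \<in> S" and "0 < a"
  shows "sum (dvd_moebius S f) {s\<in>S. s dvd a} = f a"
proof -
  have eq: "{s\<in>S. s dvd a} = insert a {s\<in>S. s dvd a \<and> s < a}"
    using assms by (auto dest: dvd_imp_le)
  have "finite {s\<in>S. s dvd a \<and> s < a}"
    by (rule finite_subset[of _ "{..<a}"]) auto
  then show ?thesis
    unfolding eq by (simp add: dvd_moebius.simps[of S f a])
qed

section \<open>Negative sums over non-principal down-sets\<close>

text \<open>A prime dividing \<open>s\<close> divides \<open>x\<close>, hence is \<open>p\<close> or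
  \<open>q\<close>; all other primes have multiplicity 0 in \<open>s\<close>. This places the
  divisors of \<open>x\<close> in a planar grid.\<close>

lemma dvd_if_multiplicity_le_two_primes:
  fixes s t x :: nat
  assumes "s dvd x" "0 < s" "0 < t" "0 < x" "prime_factors x \<subseteq> {p, q}"
    and "multiplicity p s \<le> multiplicity p t" "multiplicity q s \<le> multiplicity q t"
  shows "s dvd t"
proof (rule multiplicity_le_imp_dvd)
  show "s \<noteq> 0" using assms by simp
  fix r :: nat assume "prime r"
  show "multiplicity r s \<le> multiplicity r t"
  proof (cases "r dvd s")
    case True
    then have "r \<in> prime_factors x"
      using assms \<open>prime r\<close> by (auto simp: prime_factors_dvd)
    then show ?thesis using assms by auto
  qed (simp add: not_dvd_imp_multiplicity_0)
qed

text \<open>Dividing \<open>y\<close> and \<open>t\<close> by their gcd leaves distinct cofactors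
  that are at least 2, so their reciprocals add up to at most 1/2 + 1/3 < 1.\<close>

lemma inverse_add_less_inverse_gcd:
  fixes y t :: nat
  assumes "\<not> y dvd t" and "\<not> t dvd y"
  shows "1 / real y + 1 / real t < 1 / real (gcd y t)"
proof -
  define g where "g = gcd y t"
  have g: "0 < g"
    using assms by (cases "y = 0") (auto simp: g_def)
  obtain k l where kl: "y = k * g" "t = l * g" "coprime k l"
    unfolding g_def using gcd_coprime_exists[of y t] g g_def by auto
  have "\<not> k dvd l" "\<not> l dvd k"
    using assms kl by auto
  then have "k \<noteq> 1" "l \<noteq> 1" "k \<noteq> 0" "l \<noteq> 0" "k \<noteq> l"
    by (metis one_dvd, metis one_dvd, metis dvd_0_right, metis dvd_0_right, metis dvd_refl)
  then have "2 \<le> k \<and> 3 \<le> l \<or> 3 \<le> k \<and> 2 \<le> l"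
    by linarith
  then have "1 / real k + 1 / real l \<le> 1 / 2 + 1 / 3"
  proof
    assume "2 \<le> k \<and> 3 \<le> l"
    then show ?thesis
      by (intro add_mono divide_left_mono) auto
  next
    assume "3 \<le> k \<and> 2 \<le> l"
    then have "1 / real l + 1 / real k \<le> 1 / 2 + 1 / 3"
      by (intro add_mono divide_left_mono) auto
    then show ?thesis by linarith
  qed
  then have "(1 / real k + 1 / real l) / g < 1 / g"
    using g by (intro divide_strict_right_mono) auto
  then show ?thesis
    unfolding g_def[symmetric] by (simp add: kl add_divide_distrib)
qed

text \<open>Induction on \<open>D\<close>, splitting off the divisors of one extreme element
  \<open>t\<close>. The down-set \<open>F\<close> generated by the other elements is either
  principal, which is the base case, or covered by the induction hypothesis.\<close>

lemma sum_downset_negative: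
  fixes S D :: "nat set" and \<psi> :: "nat \<Rightarrow> real"
  assumes pos: "\<And>a. a \<in> S \<Longrightarrow> 0 < a" and closed: "gcd_closed S"
    and psi: "\<And>a. a \<in> S \<Longrightarrow> sum \<psi> {s\<in>S. s dvd a} = 1 / real a"
    and x: "0 < x" "prime_factors x \<subseteq> {p, q}"
    and "finite D" "D \<noteq> {}" "D \<subseteq> S" "\<And>s. s \<in> D \<Longrightarrow> s dvd x"
    and "\<And>r s. r \<in> S \<Longrightarrow> s \<in> D \<Longrightarrow> r dvd s \<Longrightarrow> r \<in> D"
    and "\<And>y. y \<in> D \<Longrightarrow> D \<noteq> {s\<in>S. s dvd y}"
  shows "sum \<psi> D < 0"
  using assms(6-)
proof (induction D rule: finite_psubset_induct)
  case (psubset D)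
  define P where "P = multiplicity p"
  define Q where "Q = multiplicity q"
  have P_mono: "P r \<le> P s" and Q_mono: "Q r \<le> Q s" if "r dvd s" "s \<in> D" for r s
    using that pos psubset.prems(2) unfolding P_def Q_def
    by (auto intro!: dvd_imp_multiplicity_le)
  have dvdI: "s dvd t" if "s \<in> D" "t \<in> D" "P s \<le> P t" "Q s \<le> Q t" for s t
    using dvd_if_multiplicity_le_two_primes[of s x t p q] that x pos psubset.prems(2,3)
    unfolding P_def Q_def by auto
  have fin: "finite (P ` D)" "P ` D \<noteq> {}"
    using psubset.hyps psubset.prems(1) by auto
  \<comment> \<open>The corner \<open>t\<close> has the largest exponent of \<open>p\<close> in
    \<open>D\<close> and, among those elements, the largest exponent of \<open>q\<close>.\<close>
  let ?E = "{s\<in>D. P s = Max (P ` D)}"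
  have E: "finite (Q ` ?E)" "Q ` ?E \<noteq> {}"
    using psubset.hyps Max_in[OF fin] by auto
  obtain t where t: "t \<in> ?E" "Q t = Max (Q ` ?E)"
    using Max_in[OF E] by auto
  then have tD: "t \<in> D" by simp
  have tP: "P s \<le> P t" if "s \<in> D" for s
    using t that fin by auto
  have tQ: "Q s \<le> Q t" if "s \<in> D" "P s = P t" for s
    using t that E by auto
  let ?T = "{s\<in>S. s dvd t}"
  have TD: "?T \<subseteq> D" using psubset.prems(4)[OF _ tD] by auto
  define N where "N = {s\<in>D. \<not> s dvd t}"
  have DN: "D \<subseteq> N \<union> ?T" using psubset.prems(2) by (auto simp: N_def)
  have "N \<noteq> {}" using psubset.prems(5)[OF tD] TD DN by auto
  have "finite N" using psubset.hyps by (simp add: N_def)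
  \<comment> \<open>As \<open>P t\<close> is maximal, an element can fail to divide \<open>t\<close>
    only through its exponent of \<open>q\<close>.\<close>
  have QN: "Q t < Q s" if "s \<in> N" for s
    using dvdI[of s t] tP[of s] that tD unfolding N_def by force
  define F where "F = {r\<in>S. \<exists>s\<in>N. r dvd s}"
  have FD: "F \<subseteq> D"
    using psubset.prems(4) by (auto simp: F_def N_def)
  have NF: "N \<subseteq> F"
    using psubset.prems(2) by (auto simp: F_def N_def)
  have F_down: "r \<in> F" if "r \<in> S" "s \<in> F" "r dvd s" for r s
    using that by (auto simp: F_def intro: dvd_trans)
  have tF: "t \<notin> F"
  proof
    assume "t \<in> F"
    then obtain s where s: "s \<in> N" "t dvd s" by (auto simp: F_def)
    then have "s \<in> D" by (simp add: N_def)
    then have "P s = P t" using P_mono[OF s(2)] tP[of s] by simp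
    then show False using tQ[of s] QN[OF s(1)] \<open>s \<in> D\<close> by simp
  qed
  have finF: "finite F" and finT: "finite ?T"
    using finite_subset[OF FD] finite_subset[OF TD] psubset.hyps by auto
  have DU: "D = F \<union> ?T" using FD NF TD DN by auto
  \<comment> \<open>Inclusion-exclusion for \<open>F\<close> and \<open>?T\<close>: an element
    \<open>u\<close> of \<open>F\<close> that bounds all of \<open>F \<inter> ?T\<close> makes this
    intersection the set of divisors of \<open>gcd t u\<close>.\<close>
  have meet: "sum \<psi> D = sum \<psi> F + 1 / t - 1 / gcd t u"
    if u: "u \<in> F" "\<And>s. s \<in> F \<Longrightarrow> s dvd t \<Longrightarrow> s dvd u" for u
  proof -
    have "F \<inter> ?T = {s\<in>S. s dvd gcd t u}"
      using u F_down[OF _ u(1)] by (auto simp: F_def)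
    moreover have "t \<in> S" "u \<in> S"
      using tD u(1) FD psubset.prems(2) by auto
    then have "gcd t u \<in> S"
      using closed by (simp add: gcd_closed_def)
    ultimately have "sum \<psi> (F \<inter> ?T) = 1 / gcd t u"
      by (simp only: psi)
    moreover have "sum \<psi> ?T = 1 / t" using psi \<open>t \<in> S\<close> .
    ultimately show ?thesis
      using sum_Un[OF finF finT, of \<psi>] DU by simp
  qed
  show ?case
  proof (cases "\<exists>y\<in>F. F = {s\<in>S. s dvd y}")
    case True
    then obtain y where y: "y \<in> F" "F = {s\<in>S. s dvd y}" by blast
    have "\<not> t dvd y" using tF y tD psubset.prems(2) by auto
    moreover obtain s where "s \<in> N" using \<open>N \<noteq> {}\<close> by blast
    then have "s dvd y" "\<not> s dvd t" using NF y(2) by (auto simp: N_def)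
    then have "\<not> y dvd t" using dvd_trans by blast
    ultimately have "1 / real t + 1 / real y < 1 / real (gcd t y)"
      by (rule inverse_add_less_inverse_gcd)
    moreover have "sum \<psi> D = sum \<psi> F + 1 / t - 1 / gcd t y"
      using y by (intro meet) auto
    moreover have "sum \<psi> F = 1 / y" using psi[of y] y by auto
    ultimately show ?thesis by linarith
  next
    case False
    \<comment> \<open>The bound \<open>u\<close> is an element of \<open>N\<close> with the largest
      exponent of \<open>p\<close>; its exponent of \<open>q\<close> exceeds that of every divisor
      of \<open>t\<close> because it exceeds \<open>Q t\<close>.\<close>
    have "Max (P ` N) \<in> P ` N"
      using \<open>finite N\<close> \<open>N \<noteq> {}\<close> by (intro Max_in) auto
    then obtain u where u: "Max (P ` N) = P u" "u \<in> N"
      by (rule imageE)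
    then have uF: "u \<in> F" using NF by blast
    have "s dvd u" if s: "s \<in> F" "s dvd t" for s
    proof (rule dvdI)
      obtain v where v: "v \<in> N" "s dvd v" using s by (auto simp: F_def)
      then have "P s \<le> P v" using P_mono by (auto simp: N_def)
      also have "P v \<le> P u" using v \<open>finite N\<close> by (simp flip: u(1))
      finally show "P s \<le> P u" .
      show "Q s \<le> Q u" using Q_mono[OF s(2) tD] QN[OF u(2)] by simp
    qed (use s uF FD in auto)
    then have "sum \<psi> D = sum \<psi> F + 1 / t - 1 / gcd t u"
      using uF by (intro meet) auto
    moreover have "sum \<psi> F < 0"
    proof (rule psubset.IH)
      show "F \<subset> D" using FD tF tD by blast
      show "F \<noteq> {}" using uF by blast
      show "F \<subseteq> S" by (auto simp: F_def)
      show "s dvd x" if "s \<in> F" for s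
        using that FD psubset.prems(3)[of s] by auto
      show "r \<in> F" if "r \<in> S" "s \<in> F" "r dvd s" for r s
        using that by (rule F_down)
      show "F \<noteq> {s\<in>S. s dvd y}" if "y \<in> F" for y
        using that False by auto
    qed
    moreover have "1 / real t \<le> 1 / real (gcd t u)"
      using pos[of t] tD psubset.prems(2) by (intro divide_left_mono) auto
    ultimately show ?thesis by linarith
  qed
qed

lemma dvd_moebius_inverse_nonzero:
  assumes pos: "\<And>a. a \<in> S \<Longrightarrow> 0 < a" and closed: "gcd_closed S"
    and x: "x \<in> S" "card (prime_factors x) \<le> 2"
  shows "dvd_moebius S (\<lambda>a. 1 / real a) x \<noteq> 0"
proof -
  let ?\<psi> = "dvd_moebius S (\<lambda>a. 1 / real a)"
  have psi: "sum ?\<psi> {s\<in>S. s dvd a} = 1 / real a" if "a \<in> S" for a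
    using sum_dvd_moebius that pos by blast
  \<comment> \<open>With fewer than two prime factors, \<open>p\<close> and \<open>q\<close> may
    coincide or be arbitrary.\<close>
  obtain p q where pq: "prime_factors x \<subseteq> {p, q}"
  proof -
    have "card (prime_factors x) = 0 \<or> card (prime_factors x) = 1 \<or> card (prime_factors x) = 2"
      using x(2) by linarith
    then show ?thesis
      using that by (auto simp: card_0_eq card_1_singleton_iff card_2_iff)
  qed
  have "0 < x" using pos x by blast
  define D where "D = {s\<in>S. s dvd x \<and> s < x}"
  have eq: "?\<psi> x = 1 / x - sum ?\<psi> D"
    by (simp add: D_def dvd_moebius.simps[of S _ x])
  have finD: "finite D"
    by (rule finite_subset[of _ "{..<x}"]) (auto simp: D_def)
  \<comment> \<open>The empty \<open>D\<close> is split off because its sum is 0, not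
    negative.\<close>
  consider "D = {}" | y where "y \<in> D" "D = {s\<in>S. s dvd y}"
    | "D \<noteq> {}" "\<And>y. y \<in> D \<Longrightarrow> D \<noteq> {s\<in>S. s dvd y}" by blast
  then show ?thesis
  proof cases
    case 1
    then show ?thesis using eq \<open>0 < x\<close> by simp
  next
    case 2
    then have "sum ?\<psi> D = 1 / y" using psi[of y] by (auto simp: D_def)
    moreover have "0 < y" "y < x" using 2 pos by (auto simp: D_def)
    then have "1 / real x < 1 / real y" by (intro divide_strict_left_mono) auto
    ultimately show ?thesis using eq by linarith
  next
    case 3
    have "sum ?\<psi> D < 0"
    proof (rule sum_downset_negative[OF pos closed psi \<open>0 < x\<close> pq finD 3(1) _ _ _ 3(2)])
      show "r \<in> D" if "r \<in> S" "s \<in> D" "r dvd s" for r s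
      proof -
        have "s dvd x" "s < x" "0 < s" using that pos by (auto simp: D_def)
        then have "r dvd x" "r < x"
          using dvd_trans[OF that(3)] dvd_imp_le[OF that(3)] by auto
        then show ?thesis using that by (simp add: D_def)
      qed
    qed (auto simp: D_def)
    moreover have "0 < 1 / real x" using \<open>0 < x\<close> by simp
    ultimately show ?thesis using eq by linarith
  qed
qed

section \<open>Triviality of the kernel\<close>

text \<open>Injectivity of the unitriangular incidence matrix, solved upwards: the terms at proper
  divisors vanish by induction.\<close>

lemma sum_over_divisors_zero_imp_zero:
  fixes w :: "nat \<Rightarrow> 'a::comm_monoid_add"
  assumes pos: "\<And>a. a \<in> S \<Longrightarrow> 0 < a"
    and zero: "\<And>a. a \<in> S \<Longrightarrow> sum w {s\<in>S. s dvd a} = 0"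
    and "a \<in> S"
  shows "w a = 0"
  using \<open>a \<in> S\<close>
proof (induction a rule: less_induct)
  case (less a)
  have "finite {s\<in>S. s dvd a}"
    by (rule finite_subset[of _ "{..a}"]) (use pos[OF less.prems] in \<open>auto dest: dvd_imp_le\<close>)
  moreover have "a \<in> {s\<in>S. s dvd a}" using less.prems by simp
  moreover have "sum w ({s\<in>S. s dvd a} - {a}) = 0"
  proof (intro sum.neutral ballI)
    fix s assume "s \<in> {s\<in>S. s dvd a} - {a}"
    then have s: "s \<in> S" "s dvd a" "s \<noteq> a" by auto
    then have "s < a"
      using dvd_imp_le[OF s(2) pos[OF less.prems]] by simp
    then show "w s = 0" using s(1) by (rule less.IH)
  qed
  ultimately have "sum w {s\<in>S. s dvd a} = w a"
    by (simp only: sum.remove[of "{s\<in>S. s dvd a}" a w] add_0_right)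
  then show ?case using zero[OF less.prems] by (simp only:)
qed

text \<open>The same for the transposed incidence matrix, solved downwards from
  \<open>Max S\<close>.\<close>

lemma sum_over_multiples_zero_imp_zero:
  fixes w :: "nat \<Rightarrow> 'a::comm_monoid_add"
  assumes "finite S" and pos: "\<And>a. a \<in> S \<Longrightarrow> 0 < a"
    and zero: "\<And>a. a \<in> S \<Longrightarrow> sum w {s\<in>S. a dvd s} = 0"
    and "a \<in> S"
  shows "w a = 0"
  using \<open>a \<in> S\<close>
proof (induction "Max S - a" arbitrary: a rule: less_induct)
  case less
  have "w s = 0" if "s \<in> {s\<in>S. a dvd s} - {a}" for s
  proof -
    have s: "s \<in> S" "a dvd s" "s \<noteq> a" using that by auto
    then have "a < s" using dvd_imp_le[OF s(2) pos[OF s(1)]] by simp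
    moreover have "s \<le> Max S" using \<open>finite S\<close> s(1) by (rule Max_ge)
    ultimately have "Max S - s < Max S - a" by linarith
    then show ?thesis using s(1) by (rule less.hyps)
  qed
  then have "sum w ({s\<in>S. a dvd s} - {a}) = 0"
    by (intro sum.neutral ballI)
  moreover have "finite {s\<in>S. a dvd s}" "a \<in> {s\<in>S. a dvd s}"
    using \<open>finite S\<close> less.prems by auto
  ultimately have "sum w {s\<in>S. a dvd s} = w a"
    by (simp only: sum.remove[of "{s\<in>S. a dvd s}" a w] add_0_right)
  then show ?case using zero[OF less.prems] by (simp only:)
qed

text \<open>The factorization is applied to a vector and its factors are cancelled in turn:
  incidence matrix, diagonal of \<open>?\<psi>\<close>, transposed incidence matrix, scaling by
  \<open>b\<close>.\<close>

lemma lcm_kernel_trivial: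
  fixes c :: "nat \<Rightarrow> real"
  assumes fin: "finite S" and pos: "\<And>a. a \<in> S \<Longrightarrow> 0 < a" and closed: "gcd_closed S"
    and two: "\<And>a. a \<in> S \<Longrightarrow> card (prime_factors a) \<le> 2"
    and ker: "\<And>a. a \<in> S \<Longrightarrow> (\<Sum>b\<in>S. real (lcm a b) * c b) = 0"
    and "b \<in> S"
  shows "c b = 0"
proof -
  let ?\<psi> = "dvd_moebius S (\<lambda>a. 1 / real a)"
  \<comment> \<open>The transposed incidence matrix applied to the scaled vector
    \<open>real b * c b\<close>.\<close>
  define C where "C s = (\<Sum>b\<in>{b\<in>S. s dvd b}. real b * c b)" for s
  have zero: "(\<Sum>s\<in>{s\<in>S. s dvd a}. ?\<psi> s * C s) = 0" if a: "a \<in> S" for a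
  proof -
    have "(\<Sum>s\<in>{s\<in>S. s dvd a}. ?\<psi> s * C s)
      = (\<Sum>s\<in>S. \<Sum>b\<in>S. if s dvd a \<and> s dvd b then ?\<psi> s * (real b * c b) else 0)"
      unfolding sum.inter_filter[OF fin]
    proof (rule sum.cong)
      fix s
      show "(if s dvd a then ?\<psi> s * C s else 0)
          = (\<Sum>b\<in>S. if s dvd a \<and> s dvd b then ?\<psi> s * (real b * c b) else 0)"
        by (simp add: C_def sum_distrib_left sum.inter_filter[OF fin] if_distrib cong: if_cong)
    qed simp
    also have "\<dots> = (\<Sum>b\<in>S. \<Sum>s\<in>S. if s dvd a \<and> s dvd b then ?\<psi> s * (real b * c b) else 0)"
      by (rule sum.swap)
    also have "\<dots> = (\<Sum>b\<in>S. (\<Sum>s\<in>{s\<in>S. s dvd gcd a b}. ?\<psi> s) * (real b * c b))"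
    proof (rule sum.cong)
      fix b
      show "(\<Sum>s\<in>S. if s dvd a \<and> s dvd b then ?\<psi> s * (real b * c b) else 0)
          = (\<Sum>s\<in>{s\<in>S. s dvd gcd a b}. ?\<psi> s) * (real b * c b)"
        unfolding sum_distrib_right sum.inter_filter[OF fin] by (auto intro!: sum.cong)
    qed simp
    also have "\<dots> = (\<Sum>b\<in>S. 1 / real (gcd a b) * (real b * c b))"
    proof (rule sum.cong)
      fix b assume "b \<in> S"
      then have "gcd a b \<in> S" using closed a by (auto simp: gcd_closed_def)
      then show "(\<Sum>s\<in>{s\<in>S. s dvd gcd a b}. ?\<psi> s) * (real b * c b)
          = 1 / real (gcd a b) * (real b * c b)"
        using sum_dvd_moebius[OF \<open>gcd a b \<in> S\<close> pos[OF \<open>gcd a b \<in> S\<close>], of "\<lambda>a. 1 / real a"]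
        by (simp only:)
    qed simp
    also have "\<dots> = (\<Sum>b\<in>S. real (lcm a b) * c b / real a)"
    proof (rule sum.cong)
      fix b assume "b \<in> S"
      have "real (gcd a b) * real (lcm a b) = real a * real b"
        by (simp flip: of_nat_mult prod_gcd_lcm_nat)
      moreover have "0 < a" using a by (rule pos)
      moreover from this have "0 < gcd a b" by simp
      ultimately have "real (lcm a b) = real a * real b / real (gcd a b)"
        by (simp add: eq_divide_eq mult.commute)
      with \<open>0 < a\<close> show "1 / real (gcd a b) * (real b * c b) = real (lcm a b) * c b / real a"
        by simp
    qed simp
    also have "\<dots> = 0" using ker[OF a] by (simp flip: sum_divide_distrib)
    finally show ?thesis .
  qed
  have "?\<psi> a * C a = 0" if "a \<in> S" for a
    by (rule sum_over_divisors_zero_imp_zero[of S "\<lambda>s. ?\<psi> s * C s", OF pos zero that])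
  then have C: "C a = 0" if "a \<in> S" for a
    using dvd_moebius_inverse_nonzero[OF pos closed that two[OF that]] that
    by (metis mult_eq_0_iff)
  have "real b * c b = 0"
    by (rule sum_over_multiples_zero_imp_zero[of S "\<lambda>b. real b * c b",
          OF fin pos C[unfolded C_def] \<open>b \<in> S\<close>])
  then show ?thesis using pos[OF \<open>b \<in> S\<close>] by simp
qed

theorem theorem5p1:
  fixes S :: "nat set" and n :: nat and x :: "nat \<Rightarrow> nat"
  assumes "bij_betw x {..<n} S"
    and "\<And>a. a \<in> S \<Longrightarrow> 0 < a"
    and "gcd_closed S"
    and "\<And>a. a \<in> S \<Longrightarrow> card (prime_factors a) \<le> 2"
  shows "invertible_mat (lcm_matrix n x)"
proof -
  let ?A = "lcm_matrix n x"
  have A: "?A \<in> carrier_mat n n" by (simp add: lcm_matrix_def)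
  have fin: "finite S" using assms(1) bij_betw_finite by blast
  have "v = 0\<^sub>v n" if v: "v \<in> carrier_vec n" "?A *\<^sub>v v = 0\<^sub>v n" for v
  proof -
    \<comment> \<open>The vector is reindexed by the elements of \<open>S\<close> instead of their
      positions.\<close>
    define c where "c = (\<lambda>b. v $ the_inv_into {..<n} x b)"
    have c: "c (x j) = v $ j" if "j < n" for j
      using that assms(1) by (simp add: c_def the_inv_into_f_f bij_betw_def)
    have "(\<Sum>b\<in>S. real (lcm a b) * c b) = 0" if "a \<in> S" for a
    proof -
      obtain i where i: "i < n" "a = x i" using \<open>a \<in> S\<close> assms(1) by (auto simp: bij_betw_def)
      have "(\<Sum>b\<in>S. real (lcm a b) * c b) = (\<Sum>j<n. real (lcm a (x j)) * c (x j))"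
        using sum.reindex_bij_betw[OF assms(1)] by (rule sym)
      also have "\<dots> = (?A *\<^sub>v v) $ i"
        using i v(1) c by (auto simp: lcm_matrix_def scalar_prod_def lessThan_atLeast0)
      finally show ?thesis using v(2) i by simp
    qed
    then have "c b = 0" if "b \<in> S" for b
      using lcm_kernel_trivial[OF fin assms(2-4)] that by blast
    then have "v $ j = 0" if "j < n" for j
      using c[OF that] that assms(1) by (metis bij_betwE lessThan_iff)
    then show ?thesis using v(1) by auto
  qed
  then have "det ?A \<noteq> 0"
    using det_0_iff_vec_prod_zero_field[OF A] by blast
  then obtain B where "B \<in> carrier_mat n n" "B * ?A = 1\<^sub>m n" "?A * B = 1\<^sub>m n"
    using det_non_zero_imp_unit[OF A, of "TYPE(real)"] unfolding Units_def
    by (auto simp: ring_mat_def)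
  then show ?thesis
    using A unfolding invertible_mat_def inverts_mat_def by auto
qed

end
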